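(* Let $G$ be a graph with $n$ vertices, and let $b,a,n',m,\Delta$ be non-negative integers with $b-\Delta\ge a\ge 2$, $\delta(G)\ge m+n'+\frac{b(b-\Delta)}{\Delta+a}$ and $n>\frac{(b+a+2m-1)(a+b)}{\Delta+a}+n'$. Let $g,f$ be integer-valued functions on $V(G)$ with $b-\Delta\ge f(x)-\Delta\ge g(x)\ge a$ for every vertex $x$. If for every pair of distinct non-adjacent vertices $x,y$ (i.e. $xy\notin E(G)$) we have $\max\{d_G(x),d_G(y)\}\ge\frac{(b-\Delta)n+(\Delta+a)n'}{b+a}$, then $G$ is fractional $(g,f,n',m)$-critical deleted.
   Context: All graphs are finite and simple; $\delta(G)$ is the minimum degree and $d_G(x)$ the degree of $x$. For integer-valued functions $g\le f$ on $V(G)$, a fractional $(g,f)$-factor of $G$ is a function $h:E(G)\to[0,1]$ such that $g(x)\le\sum_{e\ni x}h(e)\le f(x)$ for every vertex $x$. $G$ is fractional $(g,f,m)$-deleted if for every $H\subseteq E(G)$ with $|H|=m$, $G-H$ has a fractional $(g,f)$-factor. $G$ is fractional $(g,f,n',m)$-critical deleted if for every $U\subseteq V(G)$ with $|U|=n'$, $G-U$ is fractional $(g,f,m)$-deleted (with $g,f$ restricted to $V(G)\setminus U$). *)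

theory Defs
  imports Complex_Main
begin

definition simple_graph :: "'a set \<Rightarrow> 'a set set \<Rightarrow> bool" where
  "simple_graph V E \<longleftrightarrow> finite V \<and> (\<forall>e\<in>E. e \<subseteq> V \<and> card e = 2)"

definition incident_edges :: "'a set set \<Rightarrow> 'a \<Rightarrow> 'a set set" where
  "incident_edges E x = {e \<in> E. x \<in> e}"

definition vertex_degree :: "'a set set \<Rightarrow> 'a \<Rightarrow> nat" where
  "vertex_degree E x = card (incident_edges E x)"

text \<open>Only meaningful for a nonempty finite vertex set.\<close>
definition min_degree :: "'a set \<Rightarrow> 'a set set \<Rightarrow> nat" where
  "min_degree V E = Min (vertex_degree E ` V)"

text \<open>The edge set of \<open>G - U\<close>; its vertex set is \<open>V - U\<close>.\<close>
definition edges_minus :: "'a set set \<Rightarrow> 'a set \<Rightarrow> 'a set set" where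
  "edges_minus E U = {e \<in> E. e \<inter> U = {}}"

text \<open>The values of \<open>g\<close> and \<open>f\<close> outside \<open>V\<close>, and of \<open>h\<close> outside \<open>E\<close>, are irrelevant;
  so restricting \<open>g\<close> and \<open>f\<close> to a smaller vertex set needs no notation.\<close>
definition fractional_factor ::
  "'a set \<Rightarrow> 'a set set \<Rightarrow> ('a \<Rightarrow> int) \<Rightarrow> ('a \<Rightarrow> int) \<Rightarrow> ('a set \<Rightarrow> real) \<Rightarrow> bool" where
  "fractional_factor V E g f h \<longleftrightarrow>
     (\<forall>e\<in>E. 0 \<le> h e \<and> h e \<le> 1) \<and>
     (\<forall>x\<in>V. of_int (g x) \<le> (\<Sum>e\<in>incident_edges E x. h e) \<and>
            (\<Sum>e\<in>incident_edges E x. h e) \<le> of_int (f x))"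

definition fractional_deleted ::
  "'a set \<Rightarrow> 'a set set \<Rightarrow> ('a \<Rightarrow> int) \<Rightarrow> ('a \<Rightarrow> int) \<Rightarrow> nat \<Rightarrow> bool" where
  "fractional_deleted V E g f m \<longleftrightarrow>
     (\<forall>H. H \<subseteq> E \<and> card H = m \<longrightarrow> (\<exists>h. fractional_factor V (E - H) g f h))"

definition fractional_critical_deleted ::
  "'a set \<Rightarrow> 'a set set \<Rightarrow> ('a \<Rightarrow> int) \<Rightarrow> ('a \<Rightarrow> int) \<Rightarrow> nat \<Rightarrow> nat \<Rightarrow> bool" where
  "fractional_critical_deleted V E g f n' m \<longleftrightarrow>
     (\<forall>U. U \<subseteq> V \<and> card U = n' \<longrightarrow> fractional_deleted (V - U) (edges_minus E U) g f m)"

end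

theory Submission
  imports Defs
begin

text \<open>A fractional \<open>(g, f)\<close>-factor exists if \<open>g(T) \<le> f(S) + \<Sum>\<^bsub>x \<in> T\<^esub> d\<^bsub>G - S\<^esub>(x)\<close> for all disjoint
  \<open>S\<close> and \<open>T\<close> (Anstee). This is max-flow min-cut on the bipartite double cover of the graph: an arc
  set of least total deficiency has no alternating augmenting path, so the vertices reachable from
  a deficient one would violate the cut condition; averaging over the two orientations of an edge
  gives the fractional factor.

  Put \<open>A = a + \<Delta>\<close>, \<open>B = b - \<Delta>\<close> and \<open>N = n - n'\<close>. Given \<open>U\<close>, \<open>H\<close>, \<open>S\<close> and \<open>T\<close>, let \<open>d x\<close> be the degree
  of \<open>x\<close> in \<open>G - U - H - S\<close> and \<open>h x\<close> its degree in \<open>H\<close>. It suffices that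
  \<open>B |T| \<le> A |S| + \<Sum>\<^bsub>x \<in> T\<^esub> d x\<close>, where one may assume \<open>d < B\<close> on \<open>T\<close>. If \<open>|T| \<le> b\<close>, or if
  \<open>B - d x \<le> h x\<close> on \<open>T\<close>, averaging the minimum degree condition over \<open>T\<close> is enough. Otherwise let
  \<open>L\<close> be the set of those vertices of \<open>T\<close> whose degree lies below the bound of the degree
  hypothesis. It is a clique of \<open>G\<close>, hence \<open>d + h \<ge> |L| - 1\<close> on \<open>L\<close>, while \<open>d + h \<ge> \<tau>\<close> on \<open>T - L\<close> with
  \<open>\<tau> = \<lceil>B N / (A + B)\<rceil> - |S|\<close>. As \<open>\<Sum> h \<le> 2m\<close>, the claim reduces to integer inequalities, which follow
  from the lower bound on \<open>n\<close>.\<close>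

section \<open>Alternating paths in bipartite graphs\<close>

text \<open>If the new first vertex already occurs on the path, only the part from that occurrence
  on is kept. Distinctness keeps successive flips along the path from interfering.\<close>

lemma rtranclp_imp_distinct_path:
  assumes "r\<^sup>*\<^sup>* x z"
  shows "\<exists>xs. distinct (x # xs) \<and> successively r (x # xs) \<and> last (x # xs) = z"
  using assms
proof (induction rule: converse_rtranclp_induct)
  case base
  then show ?case by (intro exI[of _ "[]"]) simp
next
  case (step x y)
  then obtain xs where xs: "distinct (y # xs)" "successively r (y # xs)" "last (y # xs) = z"
    by blast
  show ?case
  proof (cases "x \<in> set (y # xs)")
    case True
    then obtain us vs where uv: "y # xs = us @ x # vs" by (meson split_list)
    have "distinct (x # vs)" "successively r (x # vs)" "last (x # vs) = z"
      using xs unfolding uv by (auto simp: successively_append_iff)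
    then show ?thesis by blast
  next
    case False
    then show ?thesis using xs step(1) by (intro exI[of _ "y # xs"]) auto
  qed
qed

section \<open>Degrees in arc sets and flips along alternating paths\<close>

definition out_deg :: "('a \<times> 'b) set \<Rightarrow> 'a \<Rightarrow> nat" where
  "out_deg F x = card (F `` {x})"

abbreviation in_deg :: "('a \<times> 'b) set \<Rightarrow> 'b \<Rightarrow> nat" where
  "in_deg F \<equiv> out_deg (F\<inverse>)"

lemma out_deg_insert:
  assumes "finite F" "(x, y) \<notin> F"
  shows "out_deg (insert (x, y) F) z = out_deg F z + of_bool (z = x)"
proof -
  have "insert (x, y) F `` {z} = (if z = x then insert y (F `` {z}) else F `` {z})" by auto
  then show ?thesis using assms by (auto simp: out_deg_def)
qed

lemma in_deg_insert:
  assumes "finite F" "(x, y) \<notin> F"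
  shows "in_deg (insert (x, y) F) z = in_deg F z + of_bool (z = y)"
proof -
  have "(insert (x, y) F)\<inverse> = insert (y, x) (F\<inverse>)" by auto
  then show ?thesis using out_deg_insert[of "F\<inverse>" y x z] assms by simp
qed

lemma out_deg_remove:
  assumes "finite F" "(x, y) \<in> F"
  shows "out_deg F z = out_deg (F - {(x, y)}) z + of_bool (z = x)"
  using out_deg_insert[of "F - {(x, y)}" x y z] assms by (simp add: insert_absorb)

lemma in_deg_remove:
  assumes "finite F" "(x, y) \<in> F"
  shows "in_deg F z = in_deg (F - {(x, y)}) z + of_bool (z = y)"
  using in_deg_insert[of "F - {(x, y)}" x y z] assms by (simp add: insert_absorb)

definition alt_step :: "('a \<times> 'b) set \<Rightarrow> ('a \<times> 'b) set \<Rightarrow> 'a \<Rightarrow> 'a \<Rightarrow> bool" where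
  "alt_step D F x x' \<longleftrightarrow> (\<exists>y. (x, y) \<in> D - F \<and> (x', y) \<in> F)"

lemma flip_alternating_path:
  assumes "finite D" "F \<subseteq> D" "distinct (x # xs)" "successively (alt_step D F) (x # xs)"
  shows "\<exists>F'\<subseteq>D. (\<forall>y. in_deg F' y = in_deg F y) \<and>
    (\<forall>z. out_deg F' z + of_bool (z = last (x # xs)) = out_deg F z + of_bool (z = x)) \<and>
    F' `` {last (x # xs)} \<subseteq> F `` {last (x # xs)}"
  using assms
proof (induction xs arbitrary: x F)
  case Nil
  then show ?case by (intro exI[of _ F]) auto
next
  case (Cons x1 xs)
  then obtain y where y: "(x, y) \<in> D" "(x, y) \<notin> F" "(x1, y) \<in> F"
    by (auto simp: alt_step_def)
  have neq: "x \<noteq> x1" and finF: "finite F" using Cons.prems finite_subset by auto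
  define F0 where "F0 = F - {(x1, y)}"
  define F1 where "F1 = insert (x, y) F0"
  have F0: "finite F0" "(x, y) \<notin> F0" using finF y by (auto simp: F0_def)
  have sub: "F1 \<subseteq> D" using y Cons.prems by (auto simp: F1_def F0_def)
  have in1: "in_deg F1 z = in_deg F z" for z
    using in_deg_insert[OF F0] in_deg_remove[OF finF y(3)] by (simp add: F1_def F0_def)
  have out1: "out_deg F1 z + of_bool (z = x1) = out_deg F z + of_bool (z = x)" for z
    using out_deg_insert[OF F0] out_deg_remove[OF finF y(3)] by (simp add: F1_def F0_def)
  have step: "alt_step D F1 u v" if "alt_step D F u v" "u \<noteq> x" "v \<noteq> x" "v \<noteq> x1" for u v
    using that y unfolding alt_step_def F1_def F0_def by blast
  have mono: "successively (alt_step D F1) (u # us)"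
    if "successively (alt_step D F) (u # us)" "x \<notin> set (u # us)" "x1 \<notin> set us" for u us
    using that
  proof (induction us arbitrary: u)
    case (Cons v us)
    then show ?case using step[of u v] by auto
  qed simp
  have "successively (alt_step D F1) (x1 # xs)"
    using Cons.prems(3,4) by (intro mono) auto
  then obtain F' where F': "F' \<subseteq> D" "\<And>z. in_deg F' z = in_deg F1 z"
    "\<And>z. out_deg F' z + of_bool (z = last (x1 # xs)) = out_deg F1 z + of_bool (z = x1)"
    "F' `` {last (x1 # xs)} \<subseteq> F1 `` {last (x1 # xs)}"
    using Cons.IH[OF Cons.prems(1) sub, of x1] Cons.prems(3) by auto
  have "last (x1 # xs) \<noteq> x" using Cons.prems(3) last_in_set[of "x1 # xs"] by fastforce
  then have "F1 `` {last (x1 # xs)} \<subseteq> F `` {last (x1 # xs)}"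
    by (auto simp: F1_def F0_def)
  moreover have "out_deg F' z + of_bool (z = last (x1 # xs)) = out_deg F z + of_bool (z = x)" for z
    using F'(3)[of z] out1[of z] by simp
  ultimately show ?case using F' in1 by (intro exI[of _ F']) auto
qed

lemma sum_out_deg_eq_in_deg:
  assumes "finite P" "finite Q" "finite F" "F \<subseteq> P \<times> UNIV" "F \<subseteq> UNIV \<times> Q"
  shows "(\<Sum>x\<in>P. out_deg F x) = (\<Sum>y\<in>Q. in_deg F y)"
proof -
  have "(\<Sum>x\<in>P. out_deg F x) = card (SIGMA x:P. F `` {x})"
    unfolding out_deg_def using assms by (subst card_SigmaI) auto
  also have "(SIGMA x:P. F `` {x}) = F" using assms by auto
  also have "card F = card (F\<inverse>)" by simp
  also have "F\<inverse> = (SIGMA y:Q. F\<inverse> `` {y})" using assms by auto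
  also have "card \<dots> = (\<Sum>y\<in>Q. in_deg F y)"
    unfolding out_deg_def using assms by (subst card_SigmaI) auto
  finally show ?thesis .
qed

section \<open>Augmentation under the cut condition\<close>

text \<open>An alternating path from \<open>x0\<close> may end at a vertex with surplus or at a
  column with room; if neither is reachable, the reachable set violates \<open>cut\<close>. The
  bound with \<open>min\<close> says that no deficit grows.\<close>

lemma augment_deficient_vertex:
  fixes gX :: "'a \<Rightarrow> int" and fY :: "'b \<Rightarrow> int"
  assumes fin: "finite X" "finite Y" and D: "D \<subseteq> X \<times> Y" and F: "F \<subseteq> D"
    and up: "\<And>y. y \<in> Y \<Longrightarrow> int (in_deg F y) \<le> fY y"
    and x0: "x0 \<in> X" "int (out_deg F x0) < gX x0"
    and cut: "\<And>P Q. P \<subseteq> X \<Longrightarrow> Q \<subseteq> Y \<Longrightarrow>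
        (\<Sum>x\<in>P. gX x) \<le> (\<Sum>y\<in>Q. fY y) + (\<Sum>x\<in>P. int (card (D `` {x} - Q)))"
  shows "\<exists>F'\<subseteq>D. out_deg F' x0 = out_deg F x0 + 1 \<and>
    (\<forall>x. x \<noteq> x0 \<longrightarrow> out_deg F' x \<le> out_deg F x) \<and>
    (\<forall>x. min (gX x) (int (out_deg F x)) \<le> int (out_deg F' x)) \<and>
    (\<forall>y\<in>Y. in_deg F y \<le> in_deg F' y \<and> int (in_deg F' y) \<le> fY y)"
proof -
  have finD: "finite D" using fin D finite_subset by blast
  have finF: "finite F" using finD F finite_subset by blast
  define P where "P = {x. (alt_step D F)\<^sup>*\<^sup>* x0 x}"
  define Q where "Q = {y. \<exists>x\<in>P. (x, y) \<in> D - F}"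
  have x0P: "x0 \<in> P" by (simp add: P_def)
  have "P \<subseteq> X"
  proof
    fix x assume "x \<in> P"
    then have "(alt_step D F)\<^sup>*\<^sup>* x0 x" by (simp add: P_def)
    then show "x \<in> X" using x0(1) F D by (cases rule: rtranclp.cases) (auto simp: alt_step_def)
  qed
  moreover have QY: "Q \<subseteq> Y" using D by (auto simp: Q_def)
  ultimately have finPQ: "finite P" "finite Q" using fin finite_subset by auto
  have into_Q: "x \<in> P" if "(x, y) \<in> F" "y \<in> Q" for x y
  proof -
    from that obtain u where "u \<in> P" "alt_step D F u x" by (auto simp: Q_def alt_step_def)
    then show ?thesis unfolding P_def by (simp add: rtranclp.rtrancl_into_rtrancl)
  qed
  have flip: "\<exists>F'\<subseteq>D. (\<forall>y. in_deg F' y = in_deg F y) \<and>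
      (\<forall>z. out_deg F' z + of_bool (z = x) = out_deg F z + of_bool (z = x0)) \<and>
      F' `` {x} \<subseteq> F `` {x}" if xP: "x \<in> P" for x
  proof -
    have "(alt_step D F)\<^sup>*\<^sup>* x0 x" using xP by (simp add: P_def)
    then obtain xs where "distinct (x0 # xs)" "successively (alt_step D F) (x0 # xs)"
      "last (x0 # xs) = x" using rtranclp_imp_distinct_path by metis
    then show ?thesis using flip_alternating_path[OF finD F, of x0 xs] by simp
  qed
  consider (row) x where "x \<in> P" "gX x < int (out_deg F x)"
    | (col) y where "y \<in> Q" "int (in_deg F y) < fY y"
    | (tight) "\<forall>x\<in>P. int (out_deg F x) \<le> gX x" "\<forall>y\<in>Q. int (in_deg F y) = fY y"
    using up QY by (meson linorder_not_le order_antisym_conv subsetD)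
  then show ?thesis
  proof cases
    case row
    then have xx0: "x \<noteq> x0" using x0 by auto
    obtain F' where F': "F' \<subseteq> D" "\<And>y. in_deg F' y = in_deg F y"
      "\<And>z. out_deg F' z + of_bool (z = x) = out_deg F z + of_bool (z = x0)"
      using flip[OF row(1)] by blast
    have "out_deg F' x0 = out_deg F x0 + 1" using F'(3)[of x0] xx0 by simp
    moreover have "out_deg F' z \<le> out_deg F z" if "z \<noteq> x0" for z using F'(3)[of z] that by simp
    moreover have "min (gX z) (int (out_deg F z)) \<le> int (out_deg F' z)" for z
      using F'(3)[of z] row(2) by (cases "z = x"; cases "z = x0") auto
    ultimately show ?thesis using F' up by (intro exI[of _ F']) auto
  next
    case col
    then obtain x where x: "x \<in> P" "(x, y) \<in> D" "(x, y) \<notin> F" by (auto simp: Q_def)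
    obtain F' where F': "F' \<subseteq> D" "\<And>y. in_deg F' y = in_deg F y"
      "\<And>z. out_deg F' z + of_bool (z = x) = out_deg F z + of_bool (z = x0)"
      "F' `` {x} \<subseteq> F `` {x}"
      using flip[OF x(1)] by blast
    define F2 where "F2 = insert (x, y) F'"
    have nF': "finite F'" "(x, y) \<notin> F'" using F' x finD finite_subset by auto
    have out: "out_deg F2 z = out_deg F z + of_bool (z = x0)" for z
      using out_deg_insert[OF nF', of z] F'(3)[of z] by (simp add: F2_def)
    have inn: "in_deg F2 z = in_deg F z + of_bool (z = y)" for z
      using in_deg_insert[OF nF', of z] F'(2)[of z] by (simp add: F2_def)
    have "int (in_deg F2 z) \<le> fY z" if "z \<in> Y" for z
      using inn[of z] up[OF that] col by auto
    then show ?thesis using F'(1) x out inn by (intro exI[of _ F2]) (auto simp: F2_def)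
  next
    case tight
    \<comment> \<open>An arc from \<open>P\<close> that ends outside \<open>Q\<close> is in
      \<open>F\<close>, by the choice of \<open>Q\<close>.\<close>
    have row: "out_deg F x = card (D `` {x} - Q) + out_deg (F \<inter> UNIV \<times> Q) x" if "x \<in> P" for x
    proof -
      have "F `` {x} = (D `` {x} - Q) \<union> (F \<inter> UNIV \<times> Q) `` {x}"
        using that F by (auto simp: Q_def)
      moreover have "finite (D `` {x} - Q)" "finite ((F \<inter> UNIV \<times> Q) `` {x})"
        using finD finF by (auto intro: finite_Image)
      moreover have "(D `` {x} - Q) \<inter> (F \<inter> UNIV \<times> Q) `` {x} = {}" by auto
      ultimately show ?thesis unfolding out_deg_def by (metis card_Un_disjoint)
    qed
    \<comment> \<open>All arcs of \<open>F\<close> into \<open>Q\<close> start in \<open>P\<close>,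
      so they can be counted from either end.\<close>
    have "(\<Sum>x\<in>P. out_deg (F \<inter> UNIV \<times> Q) x) = (\<Sum>y\<in>Q. in_deg (F \<inter> UNIV \<times> Q) y)"
      using finPQ finF into_Q by (intro sum_out_deg_eq_in_deg) auto
    also have "\<dots> = (\<Sum>y\<in>Q. in_deg F y)"
      by (intro sum.cong refl) (auto simp: out_deg_def intro!: arg_cong[where f = card])
    finally have cross: "(\<Sum>x\<in>P. out_deg (F \<inter> UNIV \<times> Q) x) = (\<Sum>y\<in>Q. in_deg F y)" .
    have "int (\<Sum>y\<in>Q. in_deg F y) = (\<Sum>y\<in>Q. fY y)" using tight(2) by simp
    with cross have "(\<Sum>x\<in>P. int (out_deg F x)) = (\<Sum>x\<in>P. int (card (D `` {x} - Q))) + (\<Sum>y\<in>Q. fY y)"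
      using row by (simp add: sum.distrib flip: of_nat_sum)
    moreover have "(\<Sum>x\<in>P. int (out_deg F x)) < (\<Sum>x\<in>P. gX x)"
      using finPQ x0 x0P tight(1) by (intro sum_strict_mono_ex1) auto
    ultimately show ?thesis using cut[OF \<open>P \<subseteq> X\<close> QY] by linarith
  qed
qed

text \<open>In an admissible arc set of least deficit no vertex is deficient, as augmentation would
  lower the deficit. In-degrees are treated through the converse, \<open>D\<close> being
  symmetric.\<close>

lemma arc_factor_of_cut_condition:
  fixes g f :: "'a \<Rightarrow> int"
  assumes fin: "finite V" and D: "D \<subseteq> V \<times> V" "sym D"
    and gf: "\<And>x. x \<in> V \<Longrightarrow> g x \<le> f x"
    and cut: "\<And>S T. S \<subseteq> V \<Longrightarrow> T \<subseteq> V \<Longrightarrow>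
        (\<Sum>x\<in>T. g x) \<le> (\<Sum>x\<in>S. f x) + (\<Sum>x\<in>T. int (card (D `` {x} - S)))"
  shows "\<exists>F\<subseteq>D. \<forall>x\<in>V. int (out_deg F x) \<in> {g x..f x} \<and> int (in_deg F x) \<in> {g x..f x}"
proof -
  define adm where "adm F \<longleftrightarrow>
    F \<subseteq> D \<and> (\<forall>x\<in>V. int (out_deg F x) \<le> f x \<and> int (in_deg F x) \<le> f x)" for F
  define deficit where "deficit F =
    (\<Sum>x\<in>V. nat (g x - int (out_deg F x)) + nat (g x - int (in_deg F x)))" for F
  have conv: "adm (F\<inverse>)" "deficit (F\<inverse>) = deficit F" if "adm F" for F
    using that D(2) by (auto simp: adm_def deficit_def sym_def add.commute)
  have improve: "\<exists>F'. adm F' \<and> deficit F' < deficit F"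
    if F: "adm F" and x0: "x0 \<in> V" "int (out_deg F x0) < g x0" for F x0
  proof -
    obtain F' where F': "F' \<subseteq> D" "out_deg F' x0 = out_deg F x0 + 1"
      "\<And>x. x \<noteq> x0 \<Longrightarrow> out_deg F' x \<le> out_deg F x"
      "\<And>x. min (g x) (int (out_deg F x)) \<le> int (out_deg F' x)"
      "\<And>y. y \<in> V \<Longrightarrow> in_deg F y \<le> in_deg F' y \<and> int (in_deg F' y) \<le> f y"
      using augment_deficient_vertex[OF fin fin D(1), of F f x0 g] F x0 cut
      unfolding adm_def by auto
    have "int (out_deg F' x) \<le> f x" if "x \<in> V" for x
    proof (cases "x = x0")
      case True
      then show ?thesis using F'(2) x0 gf[OF x0(1)] by simp
    next
      case False
      then show ?thesis using F'(3)[of x] F that unfolding adm_def by force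
    qed
    then have "adm F'" using F' by (auto simp: adm_def)
    moreover have "deficit F' < deficit F" unfolding deficit_def
    proof (rule sum_strict_mono_ex1[OF fin])
      show "\<forall>x\<in>V. nat (g x - int (out_deg F' x)) + nat (g x - int (in_deg F' x))
          \<le> nat (g x - int (out_deg F x)) + nat (g x - int (in_deg F x))"
      proof
        fix x assume x: "x \<in> V"
        show "nat (g x - int (out_deg F' x)) + nat (g x - int (in_deg F' x))
            \<le> nat (g x - int (out_deg F x)) + nat (g x - int (in_deg F x))"
          using F'(4)[of x] F'(5)[OF x] by linarith
      qed
      show "\<exists>x\<in>V. nat (g x - int (out_deg F' x)) + nat (g x - int (in_deg F' x))
          < nat (g x - int (out_deg F x)) + nat (g x - int (in_deg F x))"
        using x0 F'(2) F'(5)[OF x0(1)] by (intro bexI[of _ x0] add_less_le_mono nat_mono) auto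
    qed
    ultimately show ?thesis by blast
  qed
  \<comment> \<open>\<open>cut\<close> with \<open>S = {x}\<close> and \<open>T = {}\<close>; it
    makes the empty arc set admissible.\<close>
  have "0 \<le> f x" if "x \<in> V" for x
    using cut[of "{x}" "{}"] that by simp
  then have "adm {}" by (simp add: adm_def out_deg_def)
  then obtain F where F: "adm F" and least: "\<And>F'. adm F' \<Longrightarrow> deficit F \<le> deficit F'"
    using ex_has_least_nat[of adm "{}" deficit] by blast
  have "g x \<le> int (out_deg F x)" if "x \<in> V" for x
    using improve[OF F that] least by (meson leD not_le_imp_less)
  moreover have "g x \<le> int (in_deg F x)" if "x \<in> V" for x
    using improve[OF conv(1)[OF F] that] conv(2)[OF F] least by (metis leD not_le_imp_less)
  ultimately show ?thesis using F unfolding adm_def by (intro exI[of _ F]) auto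
qed

section \<open>A cut condition for fractional factors\<close>

lemma incident_edges_eq_image:
  assumes "\<forall>e\<in>E. card e = 2"
  shows "incident_edges E x = (\<lambda>y. {x, y}) ` {y. {x, y} \<in> E}"
proof -
  have "\<exists>y. e = {x, y}" if "e \<in> E" "x \<in> e" for e
    using assms that by (auto simp: card_2_iff)
  then show ?thesis by (auto simp: incident_edges_def)
qed

lemma inj_doubleton: "inj_on (\<lambda>y. {x, y}) A"
  by (auto simp: inj_on_def doubleton_eq_iff)

lemma vertex_degree_eq_card_neighbours:
  assumes "\<forall>e\<in>E. card e = 2"
  shows "vertex_degree E x = card {y. {x, y} \<in> E}"
  unfolding vertex_degree_def incident_edges_eq_image[OF assms]
  by (simp add: card_image inj_doubleton)

text \<open>For the double cover the sets \<open>S\<close> and \<open>T\<close> live on different sides, so they may share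
  vertices. Removing \<open>S \<inter> T\<close> from both does not increase the slack: the arcs that \<open>T - S\<close> gains
  towards \<open>S \<inter> T\<close> are matched by the lost arcs from \<open>S \<inter> T\<close> to \<open>T - S\<close>.\<close>

theorem fractional_factor_of_cut_condition:
  assumes G: "simple_graph V E"
    and gf: "\<And>x. x \<in> V \<Longrightarrow> g x \<le> f x"
    and cut: "\<And>S T. S \<subseteq> V \<Longrightarrow> T \<subseteq> V \<Longrightarrow> S \<inter> T = {} \<Longrightarrow>
        (\<Sum>x\<in>T. g x) \<le> (\<Sum>x\<in>S. f x) + (\<Sum>x\<in>T. int (card {y. {x, y} \<in> E \<and> y \<notin> S}))"
  shows "\<exists>h. fractional_factor V E g f h"
proof -
  have fin: "finite V" and E: "\<And>e. e \<in> E \<Longrightarrow> e \<subseteq> V" and E2: "\<forall>e\<in>E. card e = 2"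
    using G by (auto simp: simple_graph_def)
  define D where "D = {(x, y). {x, y} \<in> E}"
  have D: "D \<subseteq> V \<times> V" "sym D"
    using E by (auto simp: D_def sym_def insert_commute)
  have finD: "finite D" using D fin finite_subset by blast
  have nb: "{y. {x, y} \<in> E \<and> y \<notin> S} = D `` {x} - S" for x S by (auto simp: D_def)
  have finN: "finite (D `` {x})" for x using finD by (rule finite_Image)
  have overlap: "(\<Sum>x\<in>T. g x) \<le> (\<Sum>x\<in>S. f x) + (\<Sum>x\<in>T. int (card (D `` {x} - S)))"
    if ST: "S \<subseteq> V" "T \<subseteq> V" for S T
  proof -
    define I where "I = S \<inter> T"
    have finS: "finite S" and finT: "finite T" and finI: "finite I"
      using ST fin finite_subset by (auto simp: I_def intro: finite_subset)
    let ?S = "S - I" and ?T = "T - I"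
    have split: "card (D `` {x} - ?S) = card (D `` {x} - S) + card (D `` {x} \<inter> I)" for x
    proof -
      have "D `` {x} - ?S = (D `` {x} - S) \<union> (D `` {x} \<inter> I)" by (auto simp: I_def)
      moreover have "(D `` {x} - S) \<inter> (D `` {x} \<inter> I) = {}" by (auto simp: I_def)
      ultimately show ?thesis using finN by (metis card_Un_disjoint finite_Diff finite_Int)
    qed
    have "(\<Sum>x\<in>?T. card (D `` {x} \<inter> I)) = card (SIGMA x:?T. D `` {x} \<inter> I)"
      using finT finN by (subst card_SigmaI) auto
    also have "\<dots> = card (SIGMA x:I. D `` {x} \<inter> ?T)"
    proof (rule bij_betw_same_card[of prod.swap])
      show "bij_betw prod.swap (SIGMA x:?T. D `` {x} \<inter> I) (SIGMA x:I. D `` {x} \<inter> ?T)"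
        using D(2) by (intro bij_betw_byWitness[where f' = prod.swap]) (auto simp: sym_def)
    qed
    also have "\<dots> = (\<Sum>x\<in>I. card (D `` {x} \<inter> ?T))"
      using finI finN by (subst card_SigmaI) auto
    \<comment> \<open>The vertices of \<open>?T\<close> lie outside \<open>S\<close>, so these
      neighbours survive the removal of \<open>S\<close>.\<close>
    also have "\<dots> \<le> (\<Sum>x\<in>I. card (D `` {x} - S))"
      using finN by (intro sum_mono card_mono) (auto simp: I_def)
    finally have cross: "(\<Sum>x\<in>?T. int (card (D `` {x} \<inter> I))) \<le> (\<Sum>x\<in>I. int (card (D `` {x} - S)))"
      by (simp flip: of_nat_sum)
    have "(\<Sum>x\<in>?T. g x) \<le> (\<Sum>x\<in>?S. f x) + (\<Sum>x\<in>?T. int (card (D `` {x} - ?S)))"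
      using cut[of ?S ?T] ST unfolding nb by (auto simp: I_def)
    moreover have "(\<Sum>x\<in>I. g x) \<le> (\<Sum>x\<in>I. f x)"
      using gf ST by (intro sum_mono) (auto simp: I_def)
    moreover have "sum k T = sum k ?T + sum k I" "sum k S = sum k ?S + sum k I" for k :: "'a \<Rightarrow> int"
      using finS finT by (auto simp: I_def intro!: sum.subset_diff)
    ultimately show ?thesis using cross by (simp add: split sum.distrib)
  qed
  obtain F where F: "F \<subseteq> D"
    "\<And>x. x \<in> V \<Longrightarrow> int (out_deg F x) \<in> {g x..f x} \<and> int (in_deg F x) \<in> {g x..f x}"
    using arc_factor_of_cut_condition[OF fin D gf overlap] by blast
  \<comment> \<open>Half the number of orientations of \<open>e\<close> in \<open>F\<close>, so the
    sum at \<open>x\<close> is the mean of its out-degree and in-degree.\<close>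
  define h where "h e = real (card {p \<in> F. {fst p, snd p} = e}) / 2" for e
  have h: "h {x, y} = (of_bool ((x, y) \<in> F) + of_bool ((y, x) \<in> F)) / 2" if "{x, y} \<in> E" for x y
  proof -
    have "x \<noteq> y" using that E2 by force
    then have "{p \<in> F. {fst p, snd p} = {x, y}} = F \<inter> {(x, y), (y, x)}"
      by (auto simp: doubleton_eq_iff)
    then show ?thesis using \<open>x \<noteq> y\<close> by (auto simp: h_def)
  qed
  have deg: "(\<Sum>e\<in>incident_edges E x. h e) = (real (out_deg F x) + real (in_deg F x)) / 2" for x
  proof -
    have "(\<Sum>e\<in>incident_edges E x. h e) = (\<Sum>y\<in>D `` {x}. h {x, y})"
      unfolding incident_edges_eq_image[OF E2]
      by (subst sum.reindex[OF inj_doubleton]) (simp add: D_def Image_def)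
    also have "\<dots> = (\<Sum>y\<in>D `` {x}. (of_bool ((x, y) \<in> F) + of_bool ((y, x) \<in> F)) / 2)"
      by (intro sum.cong refl h) (auto simp: D_def)
    also have "\<dots> = (real (card (D `` {x} \<inter> {y. (x, y) \<in> F})) + real (card (D `` {x} \<inter> {y. (y, x) \<in> F}))) / 2"
      using finN[of x] by (simp add: sum.distrib flip: sum_divide_distrib)
    also have "D `` {x} \<inter> {y. (x, y) \<in> F} = F `` {x}" using F(1) by auto
    also have "D `` {x} \<inter> {y. (y, x) \<in> F} = F\<inverse> `` {x}" using F(1) D(2) by (auto simp: sym_def)
    finally show ?thesis by (simp add: out_deg_def)
  qed
  have "0 \<le> h e \<and> h e \<le> 1" if "e \<in> E" for e
  proof -
    have "card e = 2" using E2 that by blast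
    then obtain x y where "e = {x, y}" by (auto simp: card_2_iff)
    then show ?thesis using h[of x y] that by (auto simp: of_bool_def split: if_splits)
  qed
  moreover have "of_int (g x) \<le> (\<Sum>e\<in>incident_edges E x. h e) \<and>
      (\<Sum>e\<in>incident_edges E x. h e) \<le> of_int (f x)" if "x \<in> V" for x
  proof -
    have "real_of_int (g x) \<le> real (out_deg F x)" "real_of_int (g x) \<le> real (in_deg F x)"
      "real (out_deg F x) \<le> real_of_int (f x)" "real (in_deg F x) \<le> real_of_int (f x)"
      using F(2)[OF that] unfolding atLeastAtMost_iff
      by (metis of_int_le_iff of_int_of_nat_eq)+
    then show ?thesis unfolding deg by simp
  qed
  ultimately show ?thesis unfolding fractional_factor_def by blast
qed

section \<open>The integer inequalities\<close>

text \<open>Twice the form is a sum of three squares minus 2. For \<open>2 \<le> x\<close> at least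
  two of the squares are positive.\<close>

lemma quadratic_form_bounds:
  fixes x y :: int
  shows "- 1 \<le> x * x - x * y + y * y - x - y"
    and "2 \<le> x \<Longrightarrow> 0 \<le> x * x - x * y + y * y - x - y"
proof -
  define q where "q = x * x - x * y + y * y - x - y"
  have eq: "2 * q = (x - y)\<^sup>2 + (x - 1)\<^sup>2 + (y - 1)\<^sup>2 - 2"
    by (simp add: q_def power2_eq_square algebra_simps)
  have nonneg: "0 \<le> (x - y)\<^sup>2" "0 \<le> (x - 1)\<^sup>2" "0 \<le> (y - 1)\<^sup>2" by auto
  show "- 1 \<le> x * x - x * y + y * y - x - y"
    unfolding q_def[symmetric] using eq nonneg by linarith
  have pos: "1 \<le> z\<^sup>2" if "z \<noteq> 0" for z :: int
    using that by (smt (verit) zero_less_power2)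
  show "0 \<le> x * x - x * y + y * y - x - y" if "2 \<le> x"
    unfolding q_def[symmetric]
    using that eq nonneg pos[of "x - 1"] pos[of "x - y"] pos[of "y - 1"] by (cases "x = y") linarith+
qed

text \<open>Here \<open>t\<close>, \<open>W\<close>, \<open>D\<close> stand for the size of
  \<open>T\<close> and the sums of \<open>h\<close> and \<open>d\<close> over it; \<open>sum\<close>
  is the minimum degree condition added up over \<open>T\<close>. Failure of the claim would give
  \<open>(b - t) * (t * B) < (A - t) * D\<close>, against \<open>D \<le> t * B\<close> and
  \<open>A \<le> b\<close>.\<close>

lemma cut_inequality_few_vertices:
  fixes A B b m s t W D :: int
  assumes "A \<le> b" "1 \<le> t" "t \<le> b" "0 \<le> A" "0 \<le> B" "W \<le> t * m" "0 \<le> D" "D \<le> t * B"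
    and sum: "t * (A * m + b * B) \<le> t * (A * s) + A * W + A * D"
  shows "t * B \<le> A * s + D"
proof (rule ccontr)
  assume "\<not> ?thesis"
  then have "t * (A * s + D) < t * (t * B)" using assms by (intro mult_strict_left_mono) auto
  moreover have "A * W \<le> A * (t * m)" using assms by (intro mult_left_mono)
  ultimately have lt: "(b - t) * (t * B) < (A - t) * D"
    using sum by (simp add: algebra_simps)
  have "(A - t) * D \<le> (b - t) * (t * B)"
  proof (cases "t \<le> A")
    case True
    then show ?thesis using assms by (intro mult_mono) auto
  next
    case False
    then have "(A - t) * D \<le> 0" using assms by (intro mult_nonpos_nonneg) auto
    also have "0 \<le> (b - t) * (t * B)" using assms by simp
    finally show ?thesis .
  qed
  with lt show False by simp
qed

text \<open>Failure of the claim would give \<open>A * m < W\<close>, against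
  \<open>W \<le> 2 * m\<close> and \<open>2 \<le> A\<close>.\<close>

lemma cut_inequality_small_deficits:
  fixes A B b m s t W D :: int
  assumes "2 \<le> A" "A \<le> b" "b < t" "0 \<le> m" "0 \<le> B" "W \<le> 2 * m" "t * B - D \<le> W"
    and sum: "t * (A * m + b * B) \<le> t * (A * s) + A * W + A * D"
  shows "t * B \<le> A * s + D"
proof (rule ccontr)
  assume "\<not> ?thesis"
  then have "t * (A * s) < t * (t * B - D)" using assms by (intro mult_strict_left_mono) auto
  moreover have "t * (A * B) \<le> t * (b * B)" using assms by (intro mult_left_mono mult_right_mono) auto
  ultimately have "t * (A * m) - A * W < (t - A) * (t * B - D)"
    using sum by (simp add: algebra_simps)
  also have "\<dots> \<le> (t - A) * W" using assms by (intro mult_left_mono) auto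
  finally have "t * (A * m) < t * W" by (simp add: algebra_simps)
  then have "A * m < W" using assms by (simp add: mult_less_cancel_left)
  moreover have "2 * m \<le> A * m" using assms by (intro mult_right_mono) auto
  ultimately show False using assms by linarith
qed

text \<open>As \<open>\<tau> \<le> B\<close>, the worst case is the largest \<open>k\<close>, namely
  \<open>N - s - l\<close>. What remains is the quadratic form in \<open>\<tau>\<close> and
  \<open>l\<close> plus nonnegative terms.\<close>

lemma cut_inequality_low_threshold:
  fixes A B m s N l k \<tau> D :: int
  assumes "2 \<le> A" "2 \<le> B" "0 \<le> m"
    and kl: "s + k + l \<le> N"
    and big: "(A + B + 2 * m - 1) * (A + B) < A * N"
    and \<tau>: "1 \<le> \<tau>" "\<tau> \<le> B" "B * N - (A + B) * s \<le> (A + B) * \<tau>"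
      "(A + B) * (\<tau> - 1) < B * N - (A + B) * s"
    and D: "k * \<tau> + l * (l - 1) - 2 * m \<le> D"
  shows "(k + l) * B \<le> A * s + D"
proof -
  define C where "C = A + B"
  define w where "w = N - s"
  \<comment> \<open>The rounding error of \<open>\<tau>\<close> as a ceiling, scaled by
    \<open>C\<close>.\<close>
  define e where "e = C * \<tau> - (B * N - C * s)"
  have e: "0 \<le> e" "e < C" using \<tau> by (auto simp: e_def C_def algebra_simps)
  have C: "0 < C" using assms by (simp add: C_def)
  have "C * w = A * N + C * \<tau> - e" by (simp add: w_def e_def C_def algebra_simps)
  then have Cw: "C * (C + 2 * m - 1 + \<tau>) - e < C * w" using big by (simp add: C_def algebra_simps)
  have "C * (C + 2 * m - 2 + \<tau>) < C * w" using Cw e by (simp add: algebra_simps)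
  then have w1: "C + 2 * m - 1 + \<tau> \<le> w" using C by (simp add: mult_less_cancel_left)
  \<comment> \<open>The form may equal -1, so one extra unit is needed. It comes from
    \<open>e\<close> if \<open>e\<close> is positive; if \<open>e = 0\<close>, the bound on
    \<open>w\<close> is strict and yields an extra \<open>\<tau>\<close>.\<close>
  have "1 * \<tau> \<le> (w - C - (2 * m - 1 + \<tau>)) * \<tau>" if "e = 0"
  proof -
    have "C * (C + 2 * m - 1 + \<tau>) < C * w" using Cw that by simp
    then have "C + 2 * m - 1 + \<tau> < w" using C by (simp add: mult_less_cancel_left)
    then show ?thesis using \<tau> by (intro mult_right_mono) auto
  qed
  moreover have "0 \<le> (w - C - (2 * m - 1 + \<tau>)) * \<tau>" using w1 \<tau> by simp
  ultimately have "1 \<le> (w - C - (2 * m - 1 + \<tau>)) * \<tau> + e" using e(1) \<tau>(1) by linarith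
  moreover have "0 \<le> 2 * m * (\<tau> - 1)" using assms by simp
  moreover note quadratic_form_bounds(1)[of \<tau> l]
  ultimately have "0 \<le> (w - C - l) * \<tau> + e + l * (l - 1) - 2 * m"
    by (simp add: algebra_simps)
  moreover have "(w - l) * (\<tau> - B) \<le> k * (\<tau> - B)"
    using kl \<tau>(2) by (intro mult_right_mono_neg) (auto simp: w_def)
  moreover have "A * s - w * B = e - C * \<tau>" by (simp add: e_def w_def C_def algebra_simps)
  ultimately show ?thesis using D by (simp add: algebra_simps)
qed

text \<open>Here \<open>\<theta>\<close> is the excess of the threshold over \<open>B\<close>. The
  lower bound on \<open>A * s\<close> loses \<open>A * \<theta>\<close>, which
  \<open>k * \<theta>\<close> and \<open>2 * m * (B - 1)\<close> make up for, since
  \<open>k * (\<theta> + 1) \<le> 2 * m\<close> and \<open>A \<le> B * k\<close>.\<close>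

lemma cut_inequality_high_threshold:
  fixes A B b m s N l k \<theta> D :: int
  assumes "2 \<le> A" "2 \<le> B" "0 \<le> m" "A \<le> b" "B \<le> b" "b < k + l" "l \<le> B"
    and big: "(A + B + 2 * m - 1) * (A + B) < A * N"
    and \<theta>: "1 \<le> \<theta>" "B * N - (A + B) * s \<le> (A + B) * (B + \<theta>)"
    and k: "k * (\<theta> + 1) \<le> 2 * m"
    and D: "k * (B + \<theta>) + l * (l - 1) - 2 * m \<le> D"
  shows "(k + l) * B \<le> A * s + D"
proof -
  define C where "C = A + B"
  have C: "0 < C" using assms by (simp add: C_def)
  have k1: "1 \<le> k" "A - B + 1 \<le> k" using assms by auto
  have "B * ((C + 2 * m - 1) * C) < B * (A * N)"
    using big assms unfolding C_def by (intro mult_strict_left_mono) auto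
  moreover have "A * (B * N - C * s) \<le> A * (C * (B + \<theta>))"
    using \<theta> assms unfolding C_def by (intro mult_left_mono) auto
  ultimately have "C * (B * (C + 2 * m - 1) - A * (B + \<theta>)) < C * (A * s)"
    by (simp add: algebra_simps)
  then have As: "B * (C + 2 * m - 1) - A * (B + \<theta>) < A * s"
    using C by (simp add: mult_less_cancel_left)
  have "A \<le> B * k"
  proof (cases "A \<le> B")
    case True
    moreover have "B * 1 \<le> B * k" using k1(1) assms by (intro mult_left_mono) auto
    ultimately show ?thesis by linarith
  next
    case False
    then have "0 \<le> (B - 1) * (A - B)" using assms by simp
    moreover have "B * (A - B + 1) \<le> B * k" using k1 assms by (intro mult_left_mono) auto
    ultimately show ?thesis by (simp add: algebra_simps)
  qed
  then have "A * \<theta> \<le> B * k * \<theta>" using \<theta> by (intro mult_right_mono) auto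
  moreover have "(B - 1) * (k * (\<theta> + 1)) \<le> (B - 1) * (2 * m)"
    using k assms by (intro mult_left_mono) auto
  moreover have "0 \<le> (B - 1) * k" using k1 assms by simp
  moreover note quadratic_form_bounds(2)[OF \<open>2 \<le> B\<close>, of l]
  ultimately show ?thesis using As D by (simp add: C_def algebra_simps)
qed

section \<open>Assembly of the cases\<close>

lemma cut_inequality:
  fixes d h :: "'a \<Rightarrow> int" and A B b m s N :: int
  assumes fin: "finite T" and L: "L \<subseteq> T"
    and params: "2 \<le> A" "2 \<le> B" "A \<le> b" "B \<le> b" "0 \<le> m" "0 \<le> s"
    and N: "s + int (card T) \<le> N" "(A + B + 2 * m - 1) * (A + B) < A * N"
    and d: "\<And>x. x \<in> T \<Longrightarrow> 0 \<le> d x" "\<And>x. x \<in> T \<Longrightarrow> d x < B"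
    and h: "\<And>x. x \<in> T \<Longrightarrow> 0 \<le> h x" "\<And>x. x \<in> T \<Longrightarrow> h x \<le> m" "(\<Sum>x\<in>T. h x) \<le> 2 * m"
    and mindeg: "\<And>x. x \<in> T \<Longrightarrow> A * m + b * B \<le> A * (s + h x + d x)"
    and low: "\<And>x. x \<in> L \<Longrightarrow> int (card L) - 1 \<le> h x + d x"
    and high: "\<And>x. x \<in> T - L \<Longrightarrow> B * N \<le> (A + B) * (s + h x + d x)"
  shows "int (card T) * B \<le> A * s + (\<Sum>x\<in>T. d x)"
proof (rule ccontr)
  assume contr: "\<not> ?thesis"
  define t where "t = int (card T)"
  define W where "W = (\<Sum>x\<in>T. h x)"
  define D where "D = (\<Sum>x\<in>T. d x)"
  define k where "k = int (card (T - L))"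
  define l where "l = int (card L)"
  define C where "C = A + B"
  have kl: "t = k + l"
    using fin L card_mono[OF fin L] by (simp add: t_def k_def l_def card_Diff_subset finite_subset)
  have C: "0 < C" using params by (simp add: C_def)
  have fail: "A * s + D < t * B" using contr by (simp add: t_def D_def)
  have D0: "0 \<le> D" using d by (auto simp: D_def intro: sum_nonneg)
  have DB: "D \<le> t * B"
    unfolding D_def t_def using d(2) by (intro sum_bounded_above[THEN order_trans]) (auto intro: less_imp_le)
  have As: "0 \<le> A * s" using params by simp
  have "t \<noteq> 0" using fail As D0 by auto
  then have t1: "1 \<le> t" by (simp add: t_def)
  have Wtm: "W \<le> t * m"
    unfolding W_def t_def using h(2) by (intro sum_bounded_above[THEN order_trans]) auto
  have "(\<Sum>x\<in>T. A * m + b * B) \<le> (\<Sum>x\<in>T. A * (s + h x + d x))"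
    using mindeg by (rule sum_mono)
  then have sum: "t * (A * m + b * B) \<le> t * (A * s) + A * W + A * D"
    by (simp add: t_def W_def D_def sum.distrib distrib_left sum_distrib_left)
  have bt: "b < t"
    using cut_inequality_few_vertices[of A b t B W m D s] params t1 Wtm D0 DB sum fail by force
  \<comment> \<open>A vertex with \<open>h x + d x < B\<close>; it later forces
    \<open>l \<le> B\<close>.\<close>
  have deficits: "\<exists>x\<in>T. h x < B - d x"
  proof (rule ccontr)
    assume "\<not> ?thesis"
    then have "(\<Sum>x\<in>T. B - d x) \<le> W" unfolding W_def by (intro sum_mono) auto
    then have "t * B - D \<le> W" by (simp add: t_def D_def sum_subtractf)
    then show False
      using cut_inequality_small_deficits[of A b t m B W D s] params bt h(3) sum fail
      by (force simp: W_def)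
  qed
  define q where "q = B * N - C * s"
  \<comment> \<open>The ceiling of \<open>q / C\<close>, written with floor division.\<close>
  define \<tau> where "\<tau> = - ((- q) div C)"
  have "t * B \<le> (N - s) * B" using N(1) params by (intro mult_right_mono) (auto simp: t_def)
  then have q: "0 < q" using fail D0 by (simp add: q_def C_def algebra_simps)
  have "- q = C * (- \<tau>) + (- q) mod C" by (simp add: \<tau>_def)
  moreover have "0 \<le> (- q) mod C" "(- q) mod C < C" using C by auto
  ultimately have \<tau>: "q \<le> C * \<tau>" "C * (\<tau> - 1) < q" by (auto simp: algebra_simps)
  have "0 < C * \<tau>" using q \<tau>(1) by linarith
  then have \<tau>1: "1 \<le> \<tau>" using C by (simp add: zero_less_mult_iff)
  have high': "\<tau> \<le> h x + d x" if "x \<in> T - L" for x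
  proof -
    have "q \<le> C * (h x + d x)" using high[OF that] by (simp add: q_def C_def algebra_simps)
    then have "C * (\<tau> - 1) < C * (h x + d x)" using \<tau> by linarith
    then show ?thesis using C by (simp add: mult_less_cancel_left)
  qed
  have split: "sum p T = sum p (T - L) + sum p L" for p :: "'a \<Rightarrow> int"
    using fin L by (rule sum.subset_diff[rotated])
  have "(\<Sum>x\<in>T - L. \<tau>) \<le> (\<Sum>x\<in>T - L. h x + d x)" using high' by (rule sum_mono)
  moreover have "(\<Sum>x\<in>L. l - 1) \<le> (\<Sum>x\<in>L. h x + d x)" using low unfolding l_def by (rule sum_mono)
  ultimately have DD: "k * \<tau> + l * (l - 1) - 2 * m \<le> D"
    using h(3) split[of d] split[of h] by (simp add: k_def l_def D_def sum.distrib)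
  show False
  proof (cases "\<tau> \<le> B")
    case True
    have "(k + l) * B \<le> A * s + D"
      using cut_inequality_low_threshold[of A B m s k l N \<tau> D] params N \<tau> \<tau>1 True DD kl
      by (simp add: q_def C_def t_def)
    then show False using fail kl by simp
  next
    case False
    have "l \<le> B"
    proof (rule ccontr)
      assume "\<not> l \<le> B"
      \<comment> \<open>With \<open>l > B\<close> and \<open>\<tau> > B\<close>, both lower bounds
        on \<open>h x + d x\<close>, namely \<open>l - 1\<close> and \<open>\<tau>\<close>, are at
        least \<open>B\<close>.\<close>
      then have "B - d x \<le> h x" if "x \<in> T" for x
        using low[of x] high'[of x] False that by (cases "x \<in> L") (auto simp: l_def)
      then show False using deficits by force
    qed
    \<comment> \<open>The summand 1 comes from \<open>d x \<le> B - 1\<close>, by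
      integrality.\<close>
    have "(\<Sum>x\<in>T - L. \<tau> - B + 1) \<le> (\<Sum>x\<in>T - L. h x)"
      using high' d(2) by (intro sum_mono) force
    also have "\<dots> \<le> 2 * m"
      using h(3) split[of h] sum_nonneg[of L h] h(1) L by force
    finally have "k * (\<tau> - B + 1) \<le> 2 * m" by (simp add: k_def)
    then have "(k + l) * B \<le> A * s + D"
      using cut_inequality_high_threshold[of A B m b k l N "\<tau> - B" s D] params N \<tau> False DD kl bt \<open>l \<le> B\<close>
      by (simp add: q_def C_def)
    then show False using fail kl by simp
  qed
qed

section \<open>Critical deleted graphs\<close>

lemma sum_vertex_degree_le:
  assumes "finite T" "finite H" "\<forall>e\<in>H. card e = 2"
  shows "(\<Sum>x\<in>T. vertex_degree H x) \<le> 2 * card H"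
proof -
  have "(\<Sum>x\<in>T. vertex_degree H x) = (\<Sum>x\<in>T. \<Sum>e\<in>H. of_bool (x \<in> e))"
    using assms(2) by (simp add: vertex_degree_def incident_edges_def Int_def)
  also have "\<dots> = (\<Sum>e\<in>H. \<Sum>x\<in>T. of_bool (x \<in> e))" by (rule sum.swap)
  also have "\<dots> = (\<Sum>e\<in>H. card (T \<inter> e))" using assms(1) by simp
  also have "\<dots> \<le> (\<Sum>e\<in>H. 2)"
  proof (rule sum_mono)
    fix e assume "e \<in> H"
    then have "card e = 2" using assms(3) by blast
    \<comment> \<open>Infinite sets have \<open>card\<close> 0, so \<open>card e = 2\<close> makes
      \<open>e\<close> finite.\<close>
    then show "card (T \<inter> e) \<le> 2"
      using card_mono[of e "T \<inter> e"] card.infinite[of e] by fastforce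
  qed
  finally show ?thesis by simp
qed

theorem theorem2:
  fixes V :: "'a set" and E :: "'a set set" and n b a n' m \<Delta> :: nat
    and g f :: "'a \<Rightarrow> int"
  assumes "simple_graph V E"
    and "card V = n"
    and "int b - int \<Delta> \<ge> int a" and "a \<ge> 2"
    and "real (min_degree V E) \<ge>
           real m + real n' + real b * (real b - real \<Delta>) / (real \<Delta> + real a)"
    and "real n > (real b + real a + 2 * real m - 1) * (real a + real b) / (real \<Delta> + real a)
           + real n'"
    and "\<forall>x\<in>V. int b - int \<Delta> \<ge> f x - int \<Delta> \<and> f x - int \<Delta> \<ge> g x \<and> g x \<ge> int a"
    and "\<forall>x\<in>V. \<forall>y\<in>V. x \<noteq> y \<and> {x, y} \<notin> E \<longrightarrow>
           real (max (vertex_degree E x) (vertex_degree E y)) \<ge>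
             ((real b - real \<Delta>) * real n + (real \<Delta> + real a) * real n') / (real b + real a)"
  shows "fractional_critical_deleted V E g f n' m"
  unfolding fractional_critical_deleted_def fractional_deleted_def
proof (intro allI impI, elim conjE)
  fix U H
  assume U: "U \<subseteq> V" "card U = n'" and H: "H \<subseteq> edges_minus E U" "card H = m"
  define A where "A = int a + int \<Delta>"
  define B where "B = int b - int \<Delta>"
  define N where "N = int n - int n'"
  define E' where "E' = edges_minus E U - H"
  have AB: "2 \<le> A" "2 \<le> B" "A \<le> int b" "B \<le> int b" "0 < A + B"
    using assms(3,4) by (auto simp: A_def B_def)
  have finV: "finite V" and EV: "\<And>e. e \<in> E \<Longrightarrow> e \<subseteq> V" and E2: "\<forall>e\<in>E. card e = 2"
    using assms(1) by (auto simp: simple_graph_def)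
  have finE: "finite E" using finV EV by (meson PowI finite_Pow_iff finite_subset subsetI)
  have HE: "H \<subseteq> E" using H by (auto simp: edges_minus_def)
  have finH: "finite H" using HE finE finite_subset by blast
  have H2: "\<forall>e\<in>H. card e = 2" using HE E2 by blast
  have G': "simple_graph (V - U) E'"
    using finV EV E2 by (fastforce simp: simple_graph_def E'_def edges_minus_def)
  have cardVU: "int (card (V - U)) = N"
    using U finV card_mono[of V U] assms(2) by (simp add: N_def card_Diff_subset finite_subset of_nat_diff)
  \<comment> \<open>\<open>\<Delta>\<close> cancels in \<open>A + B = a + b\<close>; the bound on
    \<open>n\<close> is multiplied by \<open>A\<close>.\<close>
  have "real_of_int ((A + B + 2 * int m - 1) * (A + B)) < real_of_int (A * N)"
    using assms(6) AB by (simp add: A_def B_def N_def field_simps)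
  then have big: "(A + B + 2 * int m - 1) * (A + B) < A * N" by (simp only: of_int_less_iff)
  show "\<exists>h. fractional_factor (V - U) (edges_minus E U - H) g f h"
    unfolding E'_def[symmetric]
  proof (rule fractional_factor_of_cut_condition[OF G'])
    show "g x \<le> f x" if "x \<in> V - U" for x using assms(7) that by force
  next
    fix S T assume S: "S \<subseteq> V - U" and T: "T \<subseteq> V - U" and ST: "S \<inter> T = {}"
    define d where "d x = int (card {y. {x, y} \<in> E' \<and> y \<notin> S})" for x
    define h where "h x = int (vertex_degree H x)" for x
    \<comment> \<open>Vertices with \<open>d x \<ge> g x\<close> only help the inequality. On
      \<open>T0\<close> one has \<open>d x < g x \<le> B\<close>, as the integer argument
      requires.\<close>
    define T0 where "T0 = {x \<in> T. d x < g x}"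
    define bound where "bound = ((real b - real \<Delta>) * real n + (real \<Delta> + real a) * real n') / (real b + real a)"
    define L where "L = {x \<in> T0. real (vertex_degree E x) < bound}"
    have fins: "finite S" "finite T" "finite U" "finite T0" "finite L"
      using S T U finV by (auto simp: T0_def L_def intro: finite_subset[of _ V])
    have TV: "T0 \<subseteq> V" using T by (auto simp: T0_def)
    have nbV: "{y. {x, y} \<in> X} \<subseteq> V" if "X \<subseteq> E" for x X using that EV by auto
    have degH: "h x = int (card {y. {x, y} \<in> H})" for x
      using vertex_degree_eq_card_neighbours[OF H2] by (simp add: h_def)
    have finNH: "finite {y. {x, y} \<in> H}" for x using nbV[OF HE] finV finite_subset by blast
    have finN': "finite {y. {x, y} \<in> E' \<and> y \<notin> S}" for x
      using nbV[of E' x] finV by (auto simp: E'_def edges_minus_def intro: finite_subset)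
    \<comment> \<open>A neighbour of \<open>x\<close> in \<open>E\<close> lies in \<open>U\<close>
      or \<open>S\<close>, is joined to \<open>x\<close> by an edge of \<open>H\<close>, or is
      counted by \<open>d x\<close>.\<close>
    have deg: "int (vertex_degree E x) \<le> int n' + (int (card S) + h x + d x)" if "x \<in> T0" for x
    proof -
      have "x \<notin> U" using that T by (auto simp: T0_def)
      then have "{y. {x, y} \<in> E} \<subseteq> U \<union> (S \<union> ({y. {x, y} \<in> H} \<union> {y. {x, y} \<in> E' \<and> y \<notin> S}))"
        by (auto simp: E'_def edges_minus_def)
      then have "card {y. {x, y} \<in> E} \<le> card (U \<union> (S \<union> ({y. {x, y} \<in> H} \<union> {y. {x, y} \<in> E' \<and> y \<notin> S})))"
        using fins finNH finN' by (intro card_mono) auto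
      also have "\<dots> \<le> card U + (card S + (card {y. {x, y} \<in> H} + card {y. {x, y} \<in> E' \<and> y \<notin> S}))"
        by (intro card_Un_le[THEN order_trans] add_left_mono order_refl)
      finally show ?thesis
        using vertex_degree_eq_card_neighbours[OF E2] U(2) by (simp add: degH d_def)
    qed
    \<comment> \<open>Two non-adjacent vertices cannot both have degree below
      \<open>bound\<close>.\<close>
    have clique: "{x, y} \<in> E" if "x \<in> L" "y \<in> L" "x \<noteq> y" for x y
    proof (rule ccontr)
      assume "{x, y} \<notin> E"
      then have "bound \<le> real (max (vertex_degree E x) (vertex_degree E y))"
        using assms(8) that TV by (auto simp: bound_def L_def)
      then show False using that by (auto simp: L_def max_def split: if_splits)
    qed
    have "int (card T0) * B \<le> A * int (card S) + (\<Sum>x\<in>T0. d x)"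
    proof (rule cut_inequality[where L = L and b = "int b" and m = "int m" and N = N and h = h])
      show "finite T0" by (rule fins)
      show "L \<subseteq> T0" by (auto simp: L_def)
      show "int (card S) + int (card T0) \<le> N"
      proof -
        have "card (S \<union> T0) \<le> card (V - U)"
          using S T finV by (intro card_mono) (auto simp: T0_def)
        moreover have "card (S \<union> T0) = card S + card T0"
          using fins ST by (intro card_Un_disjoint) (auto simp: T0_def)
        ultimately show ?thesis using cardVU by linarith
      qed
      show "d x < B" if "x \<in> T0" for x
        using that TV assms(7) by (force simp: T0_def B_def)
      show "h x \<le> int m" for x
        using card_mono[OF finH, of "incident_edges H x"] H(2)
        by (auto simp: h_def vertex_degree_def incident_edges_def)
      show "(\<Sum>x\<in>T0. h x) \<le> 2 * int m"
        using sum_vertex_degree_le[OF fins(4) finH H2] H(2) by (simp add: h_def flip: of_nat_sum)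
      show "A * int m + int b * B \<le> A * (int (card S) + h x + d x)" if "x \<in> T0" for x
      proof -
        have "min_degree V E \<le> vertex_degree E x"
          unfolding min_degree_def using that TV finV by (intro Min_le) auto
        then have "real m + real n' + real b * (real b - real \<Delta>) / (real \<Delta> + real a)
            \<le> real (vertex_degree E x)"
          using assms(5) by linarith
        then have "real_of_int (A * int m + int b * B) \<le> real_of_int (A * (int (vertex_degree E x) - int n'))"
          using AB by (simp add: A_def B_def field_simps)
        then have "A * int m + int b * B \<le> A * (int (vertex_degree E x) - int n')"
          by (simp only: of_int_le_iff)
        also have "\<dots> \<le> A * (int (card S) + h x + d x)"
          using deg[OF that] AB by (intro mult_left_mono) auto
        finally show ?thesis .
      qed
      \<comment> \<open>The other vertices of the clique are neighbours of \<open>x\<close> outside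
        \<open>U\<close> and \<open>S\<close>; the 1 accounts for \<open>x\<close> itself.\<close>
      show "int (card L) - 1 \<le> h x + d x" if "x \<in> L" for x
      proof -
        have "L \<subseteq> insert x ({y. {x, y} \<in> H} \<union> {y. {x, y} \<in> E' \<and> y \<notin> S})"
          using clique[OF that] that T ST by (auto simp: E'_def edges_minus_def L_def T0_def)
        then have "card L \<le> card (insert x ({y. {x, y} \<in> H} \<union> {y. {x, y} \<in> E' \<and> y \<notin> S}))"
          using finNH finN' by (intro card_mono) auto
        also have "\<dots> \<le> Suc (card {y. {x, y} \<in> H} + card {y. {x, y} \<in> E' \<and> y \<notin> S})"
          using finNH finN' by (simp add: card_insert_if card_Un_le le_SucI)
        finally show ?thesis by (simp add: degH d_def)
      qed
      \<comment> \<open>Subtracting \<open>n'\<close> from \<open>bound\<close> leaves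
        \<open>B * N / (A + B)\<close>.\<close>
      show "B * N \<le> (A + B) * (int (card S) + h x + d x)" if "x \<in> T0 - L" for x
      proof -
        have "bound \<le> real (vertex_degree E x)" using that by (auto simp: L_def)
        then have "real_of_int (B * N) \<le> real_of_int ((A + B) * (int (vertex_degree E x) - int n'))"
          using AB by (simp add: A_def B_def N_def bound_def field_simps)
        then have "B * N \<le> (A + B) * (int (vertex_degree E x) - int n')"
          by (simp only: of_int_le_iff)
        also have "\<dots> \<le> (A + B) * (int (card S) + h x + d x)"
          using deg[of x] that AB by (intro mult_left_mono) auto
        finally show ?thesis .
      qed
    qed (use AB big in \<open>auto simp: d_def h_def\<close>)
    moreover have "(\<Sum>x\<in>T. g x - d x) \<le> (\<Sum>x\<in>T0. g x - d x)"
    proof -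
      have "(\<Sum>x\<in>T. g x - d x) = (\<Sum>x\<in>T - T0. g x - d x) + (\<Sum>x\<in>T0. g x - d x)"
        using fins by (intro sum.subset_diff) (auto simp: T0_def)
      moreover have "(\<Sum>x\<in>T - T0. g x - d x) \<le> 0" by (intro sum_nonpos) (auto simp: T0_def)
      ultimately show ?thesis by linarith
    qed
    moreover have "(\<Sum>x\<in>T0. g x) \<le> int (card T0) * B"
      using TV assms(7) by (intro sum_bounded_above[where K = B, simplified]) (force simp: B_def)
    \<comment> \<open>On \<open>S\<close>, \<open>f x - \<Delta> \<ge> g x \<ge> a\<close> gives
      \<open>f x \<ge> A\<close>.\<close>
    moreover have "A * int (card S) \<le> (\<Sum>x\<in>S. f x)"
    proof -
      have "(\<Sum>x\<in>S. A) \<le> (\<Sum>x\<in>S. f x)"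
        using S assms(7) by (intro sum_mono) (force simp: A_def)
      then show ?thesis by (simp add: mult.commute)
    qed
    ultimately show "(\<Sum>x\<in>T. g x) \<le> (\<Sum>x\<in>S. f x) + (\<Sum>x\<in>T. int (card {y. {x, y} \<in> E' \<and> y \<notin> S}))"
      by (simp add: sum_subtractf flip: d_def)
  qed
qed

end
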